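(* Let $n\ge 1$, let $z_1,z_2\in\mathbb{R}$ with $z_1>0>z_2$, and put $\alpha=-(z_1+z_2)$, $\beta=z_1z_2$, so that $z_1,z_2$ are the roots of $z^2+\alpha z+\beta$. For $A,T\in M_n(\mathbb{C})$ consider the relation $$\Delta_A^2(T)+\alpha\,\Delta_A(T)+\beta\,T=0, \qquad (R)$$ and consider the condition $$(\star)\qquad j\,z_1+(k-j)\,z_2\neq 0\quad\text{for all } k\in\{1,\dots,n\},\ j\in\{1,\dots,k-1\}.$$ (i) If $(\star)$ holds, then for all $A,T\in M_n(\mathbb{C})$ satisfying $(R)$, the matrix $T$ is nilpotent, and so is $\Delta_A(T)$. (ii) If $(\star)$ fails, then there exist $A,T\in M_n(\mathbb{C})$ satisfying $(R)$ such that neither $T$ nor $\Delta_A(T)$ is nilpotent.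
   Context: $M_n(\mathbb{C})$ is the algebra of $n\times n$ complex matrices. For $A\in M_n(\mathbb{C})$ the inner derivation induced by $A$ is $\Delta_A(T)=AT-TA$ for $T\in M_n(\mathbb{C})$, and $\Delta_A^2(T)=\Delta_A(\Delta_A(T))$. A matrix $M$ is nilpotent if $M^k=0$ for some $k\ge 1$. For $k=1$ the index set $\{1,\dots,k-1\}$ is empty. *)

theory Defs
  imports Complex_Main "Jordan_Normal_Form.Matrix"
begin

text \<open>All notions below are meant for square matrices, i.e. elements of
  \<^term>\<open>carrier_mat n n\<close> for a common \<^term>\<open>n\<close>; matrix operations on arguments of
  mismatched dimensions have no intended meaning.\<close>

definition inner_derivation :: "complex mat \<Rightarrow> complex mat \<Rightarrow> complex mat" where
  "inner_derivation A T = A * T - T * A"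

definition nilpotent_mat :: "complex mat \<Rightarrow> bool" where
  "nilpotent_mat M \<longleftrightarrow> (\<exists>k::nat. k \<ge> 1 \<and> M ^\<^sub>m k = 0\<^sub>m (dim_row M) (dim_col M))"

definition derivation_relation ::
    "nat \<Rightarrow> real \<Rightarrow> real \<Rightarrow> complex mat \<Rightarrow> complex mat \<Rightarrow> bool" where
  "derivation_relation n \<alpha> \<beta> A T \<longleftrightarrow>
     inner_derivation A (inner_derivation A T)
       + complex_of_real \<alpha> \<cdot>\<^sub>m inner_derivation A T
       + complex_of_real \<beta> \<cdot>\<^sub>m T = 0\<^sub>m n n"

text \<open>For \<^term>\<open>k = (1::nat)\<close> the range of \<^term>\<open>j\<close> is empty, as \<^term>\<open>{1..0::nat} = {}\<close>.\<close>

definition nonresonant :: "nat \<Rightarrow> real \<Rightarrow> real \<Rightarrow> bool" where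
  "nonresonant n z1 z2 \<longleftrightarrow>
     (\<forall>k\<in>{1..n}. \<forall>j\<in>{1..k - 1}. real j * z1 + real (k - j) * z2 \<noteq> 0)"

end

theory Submission
  imports Defs "Jordan_Normal_Form.Schur_Decomposition"
begin

text \<open>
  Write \<open>\<Delta>\<close> for the inner derivation of \<open>A\<close>. The relation says
  \<open>(\<Delta> - z1) (\<Delta> - z2) T = 0\<close> with \<open>z1 \<noteq> z2\<close>, so \<open>T = U + V\<close> with \<open>\<Delta> U = z1 U\<close> and
  \<open>\<Delta> V = z2 V\<close>, and \<open>\<Delta> T = z1 U + z2 V\<close> is again a sum of two such eigenvectors. Since \<open>\<Delta>\<close>
  obeys the product rule, a word with \<open>j\<close> letters \<open>U\<close> and \<open>k - j\<close> letters \<open>V\<close> is an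
  eigenvector (or zero) for \<open>j z1 + (k - j) z2\<close>. Commutators have trace zero, so this word has
  trace zero as soon as that number is nonzero; nonresonance guarantees this for mixed words of
  length at most \<open>n\<close>, and \<open>z1 \<noteq> 0 \<noteq> z2\<close> does so for the pure ones. Expanding \<open>(U + V) ^ k\<close> into
  words gives \<open>tr ((U + V) ^ k) = 0\<close> for \<open>1 \<le> k \<le> n\<close> (\<open>trace_pow_sum_of_eigenvectors\<close>), and
  over \<open>\<complex>\<close> these \<open>n\<close> vanishing traces force nilpotency (\<open>nilpotent_mat_if_traces_eq_zero\<close>).

  Conversely, a resonance \<open>j z1 + (k - j) z2 = 0\<close> describes a closed walk of length \<open>k\<close> on the
  real line with \<open>j\<close> steps \<open>z1\<close> and \<open>k - j\<close> steps \<open>z2\<close>. Let \<open>A\<close> be diagonal with the visited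
  points as entries, and let \<open>T\<close> permute the first \<open>k\<close> basis vectors cyclically along the walk.
  As \<open>\<Delta>\<close> multiplies each matrix unit by the difference of the two diagonal entries, it
  multiplies the entries of \<open>T\<close> by \<open>z1\<close> or \<open>z2\<close>. So \<open>T\<close> and \<open>\<Delta> T\<close> are both cycles
  with nonzero weights, which are not nilpotent (\<open>resonant_counterexample\<close>).
\<close>

section \<open>Traces\<close>

definition mat_trace :: "'a::comm_ring_1 mat \<Rightarrow> 'a" where
  "mat_trace M = (\<Sum>i<dim_row M. M $$ (i, i))"

lemma mat_mult_index:
  assumes "A \<in> carrier_mat n m" "B \<in> carrier_mat m p" "i < n" "j < p"
  shows "(A * B) $$ (i, j) = (\<Sum>k<m. A $$ (i, k) * B $$ (k, j))"
  using assms by (simp add: scalar_prod_def atLeast0LessThan)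

lemma mat_trace_mult_commute:
  assumes "A \<in> carrier_mat n n" "B \<in> carrier_mat n n"
  shows "mat_trace (A * B) = mat_trace (B * A)"
proof -
  have "mat_trace (A * B) = (\<Sum>i<n. \<Sum>k<n. A $$ (i, k) * B $$ (k, i))"
    using assms by (simp add: mat_trace_def mat_mult_index[OF assms] del: index_mult_mat(1))
  also have "\<dots> = (\<Sum>k<n. \<Sum>i<n. B $$ (k, i) * A $$ (i, k))"
    by (subst sum.swap) (simp add: mult.commute)
  also have "\<dots> = mat_trace (B * A)"
    using assms by (simp add: mat_trace_def mat_mult_index[OF assms(2,1)] del: index_mult_mat(1))
  finally show ?thesis .
qed

lemma mat_trace_add:
  "A \<in> carrier_mat n n \<Longrightarrow> B \<in> carrier_mat n n \<Longrightarrow> mat_trace (A + B) = mat_trace A + mat_trace B"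
  by (simp add: mat_trace_def sum.distrib)

lemma mat_trace_smult: "A \<in> carrier_mat n n \<Longrightarrow> mat_trace (c \<cdot>\<^sub>m A) = c * mat_trace A"
  by (simp add: mat_trace_def sum_distrib_left)

lemma mat_trace_minus:
  "A \<in> carrier_mat n n \<Longrightarrow> B \<in> carrier_mat n n \<Longrightarrow> mat_trace (A - B) = mat_trace A - mat_trace B"
  by (simp add: mat_trace_def sum_subtractf)

lemma similar_mat_wit_trace:
  fixes A :: "'a::comm_ring_1 mat"
  assumes A: "A \<in> carrier_mat n n" and sim: "similar_mat_wit A B P Q"
  shows "mat_trace A = mat_trace B"
proof -
  note w = similar_mat_witD2[OF A sim]
  have "mat_trace A = mat_trace (P * (B * Q))"
    using w by simp
  also have "\<dots> = mat_trace (B * Q * P)"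
    using w by (subst mat_trace_mult_commute[of _ n]) auto
  also have "B * Q * P = B"
    using w by (simp add: assoc_mult_mat[of B n n Q n P n])
  finally show ?thesis .
qed

section \<open>Vanishing power sums\<close>

text \<open>Vanishing power sums of orders \<open>1\<close> to \<open>card I\<close> give \<open>\<Sum>\<^sub>i p (\<mu> i) = 0\<close> for every polynomial
  \<open>p\<close> of degree at most \<open>card I\<close> with \<open>p 0 = 0\<close>. If some value \<open>a\<close> is nonzero, take for \<open>p\<close> the
  product of the variable and the factors \<open>x - b\<close> over the nonzero values \<open>b \<noteq> a\<close>: the sum then
  reduces to \<open>p a \<noteq> 0\<close> times the multiplicity of \<open>a\<close>, a contradiction in characteristic zero.\<close>

lemma power_sums_eq_zero_imp_eq_zero:
  fixes \<mu> :: "'i \<Rightarrow> 'a::field_char_0"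
  assumes fin: "finite I"
    and ps: "\<And>k. 1 \<le> k \<Longrightarrow> k \<le> card I \<Longrightarrow> (\<Sum>i\<in>I. \<mu> i ^ k) = 0"
    and i: "i \<in> I"
  shows "\<mu> i = 0"
proof (rule ccontr)
  assume nz: "\<mu> i \<noteq> 0"
  define a where "a = \<mu> i"
  define S where "S = \<mu> ` I - {0}"
  have finS: "finite S" and aS: "a \<in> S"
    using fin i nz by (auto simp: S_def a_def)
  define p where "p = [:0, 1:] * (\<Prod>b\<in>S - {a}. [:- b, 1:])"
  have "degree p \<le> 1 + degree (\<Prod>b\<in>S - {a}. [:- b, 1:])"
    unfolding p_def using degree_mult_le[of "[:0, 1::'a:]"] by simp
  also have "degree (\<Prod>b\<in>S - {a}. [:- b, 1:]) \<le> (\<Sum>b\<in>S - {a}. degree [:- b, 1:])"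
    using finS by (intro degree_prod_sum_le[unfolded o_def]) simp
  also have "\<dots> = card S - 1"
    using finS aS by simp
  finally have "degree p \<le> 1 + (card S - 1)"
    by simp
  moreover have "card S \<ge> 1"
    using finS aS by (metis One_nat_def Suc_leI card_gt_0_iff empty_iff)
  moreover have "card S \<le> card I"
    using fin unfolding S_def by (meson Diff_subset card_image_le card_mono finite_imageI le_trans)
  ultimately have deg: "degree p \<le> card I"
    by linarith
  have c0: "coeff p 0 = 0"
    by (simp add: p_def)
  have "(\<Sum>j\<in>I. poly p (\<mu> j)) = (\<Sum>j\<in>I. \<Sum>k\<le>degree p. coeff p k * \<mu> j ^ k)"
    by (simp add: poly_altdef)
  also have "\<dots> = (\<Sum>k\<le>degree p. coeff p k * (\<Sum>j\<in>I. \<mu> j ^ k))"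
    by (subst sum.swap) (simp add: sum_distrib_left)
  also have "\<dots> = 0"
  proof (rule sum.neutral, safe)
    fix k assume "k \<le> degree p"
    then show "coeff p k * (\<Sum>j\<in>I. \<mu> j ^ k) = 0"
      using c0 ps[of k] deg by (cases "k = 0") auto
  qed
  finally have zero: "(\<Sum>j\<in>I. poly p (\<mu> j)) = 0" .
  have vanish: "poly p (\<mu> j) = 0" if "j \<in> I" "\<mu> j \<noteq> a" for j
    using that finS by (auto simp: p_def poly_prod S_def)
  have "(\<Sum>j\<in>I. poly p (\<mu> j)) = (\<Sum>j\<in>{j\<in>I. \<mu> j = a}. poly p (\<mu> j))"
    using fin vanish by (intro sum.mono_neutral_right) auto
  also have "\<dots> = of_nat (card {j\<in>I. \<mu> j = a}) * poly p a"
    by simp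
  finally have "of_nat (card {j\<in>I. \<mu> j = a}) * poly p a = 0"
    using zero by simp
  moreover have "card {j\<in>I. \<mu> j = a} \<noteq> 0"
    using fin i a_def by auto
  moreover have "poly p a \<noteq> 0"
    using finS nz by (auto simp: p_def poly_prod a_def)
  ultimately show False
    by simp
qed

section \<open>Nilpotency from vanishing traces\<close>

lemma upper_triangular_pow:
  fixes B :: "'a::comm_ring_1 mat"
  assumes B: "B \<in> carrier_mat n n" and ut: "upper_triangular B"
  shows "upper_triangular (B ^\<^sub>m k) \<and> (\<forall>i<n. (B ^\<^sub>m k) $$ (i, i) = B $$ (i, i) ^ k)"
proof (induction k)
  case 0
  then show ?case using B by auto
next
  case (Suc k)
  let ?C = "B ^\<^sub>m k"
  have C: "?C \<in> carrier_mat n n"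
    using B by simp
  have utC: "?C $$ (i, l) = 0" if "l < i" "i < n" for i l
    using Suc that C by (auto simp: upper_triangular_def)
  have utB: "B $$ (i, l) = 0" if "l < i" "i < n" for i l
    using ut that B by (auto simp: upper_triangular_def)
  have entry: "(B ^\<^sub>m Suc k) $$ (i, j) = (\<Sum>l<n. ?C $$ (i, l) * B $$ (l, j))"
    if "i < n" "j < n" for i j
    using mat_mult_index[OF C B that] by simp
  have "(B ^\<^sub>m Suc k) $$ (i, j) = 0" if "j < i" "i < n" for i j
  proof -
    have "?C $$ (i, l) * B $$ (l, j) = 0" if "l < n" for l
      using utC[of l i] utB[of j l] that \<open>j < i\<close> \<open>i < n\<close> by (cases "l < i") auto
    then show ?thesis
      using that by (simp add: entry del: pow_mat.simps)
  qed
  moreover have "(B ^\<^sub>m Suc k) $$ (i, i) = B $$ (i, i) ^ Suc k" if i: "i < n" for i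
  proof -
    have "?C $$ (i, l) * B $$ (l, i) = 0" if "l < n" "l \<noteq> i" for l
      using utC[of l i] utB[of i l] that i by (cases "l < i") auto
    then have "(\<Sum>l<n. ?C $$ (i, l) * B $$ (l, i)) = (\<Sum>l\<in>{i}. ?C $$ (i, l) * B $$ (l, i))"
      using i by (intro sum.mono_neutral_right) auto
    then show ?thesis
      using Suc i by (simp add: entry del: pow_mat.simps)
  qed
  ultimately show ?case
    using B by (auto simp: upper_triangular_def simp del: pow_mat.simps)
qed

text \<open>Each further factor moves the support of the power one more diagonal away from the main
  diagonal.\<close>

lemma strictly_upper_triangular_pow_eq_zero:
  fixes B :: "'a::comm_ring_1 mat"
  assumes B: "B \<in> carrier_mat n n"
    and st: "\<And>i j. i < n \<Longrightarrow> j \<le> i \<Longrightarrow> B $$ (i, j) = 0"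
  shows "B ^\<^sub>m n = 0\<^sub>m n n"
proof -
  have band: "(B ^\<^sub>m k) $$ (i, j) = 0" if "i < n" "j < n" "j < i + k" for i j k
    using that
  proof (induction k arbitrary: j)
    case 0
    then show ?case using B by auto
  next
    case (Suc k)
    have C: "B ^\<^sub>m k \<in> carrier_mat n n"
      using B by simp
    have "(B ^\<^sub>m k) $$ (i, l) * B $$ (l, j) = 0" if "l < n" for l
      using Suc st[of l j] that by (cases "l < i + k") auto
    then show ?case
      using mat_mult_index[OF C B] Suc.prems by simp
  qed
  show ?thesis
    by (rule eq_matI) (use B band[of _ _ n] in auto)
qed

text \<open>After Schur triangularization the traces are the power sums of the diagonal entries. Hence
  the diagonal vanishes, and what remains is strictly upper triangular.\<close>

lemma nilpotent_mat_if_traces_eq_zero: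
  assumes M: "M \<in> carrier_mat n n"
    and tr: "\<And>k. 1 \<le> k \<Longrightarrow> k \<le> n \<Longrightarrow> mat_trace (M ^\<^sub>m k) = 0"
  shows "nilpotent_mat M"
proof (cases "n = 0")
  case True
  then show ?thesis
    using M unfolding nilpotent_mat_def by (intro exI[of _ 1]) auto
next
  case False
  obtain es where "char_poly M = (\<Prod>e\<leftarrow>es. [:- e, 1:])"
    using char_poly_factorized[OF M] by blast
  moreover obtain B P Q where "schur_decomposition M es = (B, P, Q)"
    by (metis prod_cases3)
  ultimately have sim: "similar_mat_wit M B P Q" and ut: "upper_triangular B"
    using schur_decomposition[OF M] by auto
  note w = similar_mat_witD2[OF M sim]
  have B: "B \<in> carrier_mat n n"
    using w by simp
  have "B $$ (i, i) = 0" if "i < n" for i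
  proof (rule power_sums_eq_zero_imp_eq_zero[where I = "{..<n}" and \<mu> = "\<lambda>i. B $$ (i, i)"])
    fix k assume k: "1 \<le> k" "k \<le> card {..<n}"
    have "(\<Sum>i<n. B $$ (i, i) ^ k) = mat_trace (B ^\<^sub>m k)"
      using upper_triangular_pow[OF B ut, of k] B by (simp add: mat_trace_def)
    also have "\<dots> = mat_trace (M ^\<^sub>m k)"
      using similar_mat_wit_trace[OF _ similar_mat_wit_pow[OF sim]] M by (metis pow_carrier_mat)
    finally show "(\<Sum>i<n. B $$ (i, i) ^ k) = 0"
      using tr k by simp
  qed (use that in auto)
  then have "B $$ (i, j) = 0" if "i < n" "j \<le> i" for i j
    using ut B that by (cases "j = i") (auto simp: upper_triangular_def)
  then have "B ^\<^sub>m n = 0\<^sub>m n n"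
    by (rule strictly_upper_triangular_pow_eq_zero[OF B])
  then have "M ^\<^sub>m n = 0\<^sub>m n n"
    using similar_mat_wit_pow_id[OF sim, of n] w by simp
  then show ?thesis
    using M False unfolding nilpotent_mat_def by (intro exI[of _ n]) auto
qed

section \<open>Eigenvectors of an inner derivation\<close>

lemma inner_derivation_carrier [simp]:
  "A \<in> carrier_mat n n \<Longrightarrow> T \<in> carrier_mat n n \<Longrightarrow> inner_derivation A T \<in> carrier_mat n n"
  unfolding inner_derivation_def by (metis minus_carrier_mat mult_carrier_mat)

lemma inner_derivation_smult:
  assumes "A \<in> carrier_mat n n" "X \<in> carrier_mat n n"
  shows "inner_derivation A (a \<cdot>\<^sub>m X) = a \<cdot>\<^sub>m inner_derivation A X"
  unfolding inner_derivation_def mult_smult_distrib[OF assms] mult_smult_assoc_mat[OF assms(2,1)]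
  by (rule eq_matI) (use assms in \<open>auto simp: algebra_simps simp del: index_mult_mat(1)\<close>)

lemma inner_derivation_lincomb:
  assumes "A \<in> carrier_mat n n" "X \<in> carrier_mat n n" "Y \<in> carrier_mat n n"
  shows "inner_derivation A (a \<cdot>\<^sub>m X + b \<cdot>\<^sub>m Y) = a \<cdot>\<^sub>m inner_derivation A X + b \<cdot>\<^sub>m inner_derivation A Y"
proof (rule eq_matI)
  fix i j
  assume "i < dim_row (a \<cdot>\<^sub>m inner_derivation A X + b \<cdot>\<^sub>m inner_derivation A Y)"
    and "j < dim_col (a \<cdot>\<^sub>m inner_derivation A X + b \<cdot>\<^sub>m inner_derivation A Y)"
  then have ij: "i < n" "j < n"
    using assms by (auto simp: inner_derivation_def)
  show "inner_derivation A (a \<cdot>\<^sub>m X + b \<cdot>\<^sub>m Y) $$ (i, j)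
      = (a \<cdot>\<^sub>m inner_derivation A X + b \<cdot>\<^sub>m inner_derivation A Y) $$ (i, j)"
    using assms ij
    by (simp add: inner_derivation_def scalar_prod_def sum.distrib sum_distrib_left algebra_simps)
qed (use assms in \<open>auto simp: inner_derivation_def\<close>)

lemma inner_derivation_mult:
  assumes A: "A \<in> carrier_mat n n" and X: "X \<in> carrier_mat n n" and Y: "Y \<in> carrier_mat n n"
  shows "inner_derivation A (X * Y) = inner_derivation A X * Y + X * inner_derivation A Y"
proof -
  have 1: "inner_derivation A X * Y = A * X * Y - X * A * Y"
    unfolding inner_derivation_def using assms by (subst minus_mult_distrib_mat[of _ n n]) auto
  have 2: "X * inner_derivation A Y = X * A * Y - X * Y * A"
    unfolding inner_derivation_def using assms
    by (subst mult_minus_distrib_mat[of _ n n]) (auto simp: assoc_mult_mat[of _ n n _ n _ n])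
  show ?thesis
    unfolding 1 2 unfolding inner_derivation_def
    by (rule eq_matI) (use assms in \<open>auto simp: assoc_mult_mat[of _ n n _ n _ n] simp del: index_mult_mat(1)\<close>)
qed

lemma inner_derivation_eigen_mult:
  assumes A: "A \<in> carrier_mat n n" and X: "X \<in> carrier_mat n n" and Y: "Y \<in> carrier_mat n n"
    and "inner_derivation A X = a \<cdot>\<^sub>m X" "inner_derivation A Y = b \<cdot>\<^sub>m Y"
  shows "inner_derivation A (X * Y) = (a + b) \<cdot>\<^sub>m (X * Y)"
  unfolding inner_derivation_mult[OF A X Y] assms(4,5)
  using X Y by (simp add: mult_smult_distrib[of _ n n _ n] mult_smult_assoc_mat[of _ n n _ n]
      add_smult_distrib_right_mat[of _ n n])

text \<open>\<open>w X\<close> is a commutator, so \<open>w tr X = 0\<close>.\<close>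

lemma trace_inner_derivation_eigenvector:
  assumes A: "A \<in> carrier_mat n n" and X: "X \<in> carrier_mat n n"
    and eig: "inner_derivation A X = w \<cdot>\<^sub>m X" and "w \<noteq> 0"
  shows "mat_trace X = 0"
proof -
  have "w * mat_trace X = mat_trace (inner_derivation A X)"
    using X by (simp add: eig mat_trace_smult)
  also have "\<dots> = 0"
    unfolding inner_derivation_def
    using A X by (subst mat_trace_minus[of _ n]) (auto simp: mat_trace_mult_commute[of A n X])
  finally show ?thesis
    using \<open>w \<noteq> 0\<close> by simp
qed

text \<open>The extra factor \<open>X\<close> replaces the expansion into words: in \<open>(U + V) ^ (m + 1) X\<close> one factor
  \<open>U + V\<close> is absorbed by \<open>X\<close>, and \<open>U X\<close>, \<open>V X\<close> satisfy the eigenvector equation again, with \<open>w\<close> shifted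
  by \<open>u\<close> or \<open>v\<close>. After \<open>m\<close> steps the shifted values are exactly the numbers assumed to be
  nonzero.\<close>

lemma trace_pow_sum_of_eigenvectors:
  assumes A: "A \<in> carrier_mat n n" and U: "U \<in> carrier_mat n n" and V: "V \<in> carrier_mat n n"
    and eU: "inner_derivation A U = u \<cdot>\<^sub>m U" and eV: "inner_derivation A V = v \<cdot>\<^sub>m V"
    and X: "X \<in> carrier_mat n n" and eX: "inner_derivation A X = w \<cdot>\<^sub>m X"
    and nz: "\<And>j. j \<le> m \<Longrightarrow> w + of_nat j * u + of_nat (m - j) * v \<noteq> 0"
  shows "mat_trace ((U + V) ^\<^sub>m m * X) = 0"
  using X eX nz
proof (induction m arbitrary: X w)
  case 0
  then show ?case
    using trace_inner_derivation_eigenvector[OF A, of X w] V by auto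
next
  case (Suc m)
  let ?P = "(U + V) ^\<^sub>m m"
  note X = Suc.prems(1)
  have P: "?P \<in> carrier_mat n n"
    using U V by simp
  have "(U + V) ^\<^sub>m Suc m * X = ?P * ((U + V) * X)"
    using P U V X by (simp add: assoc_mult_mat[of _ n n _ n _ n])
  also have "(U + V) * X = U * X + V * X"
    using U V X by (simp add: add_mult_distrib_mat[of _ n n])
  also have "?P * (U * X + V * X) = ?P * (U * X) + ?P * (V * X)"
    using P U V X by (subst mult_add_distrib_mat[of _ n n]) auto
  also have "mat_trace \<dots> = mat_trace (?P * (U * X)) + mat_trace (?P * (V * X))"
    using P U V X by (subst mat_trace_add[of _ n]) auto
  also have "mat_trace (?P * (U * X)) = 0"
  proof (rule Suc.IH[OF _ inner_derivation_eigen_mult[OF A U X eU Suc.prems(2)]])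
    show "u + w + of_nat j * u + of_nat (m - j) * v \<noteq> 0" if "j \<le> m" for j
      using Suc.prems(3)[of "Suc j"] that by (simp add: algebra_simps)
  qed (use U X in auto)
  also have "mat_trace (?P * (V * X)) = 0"
  proof (rule Suc.IH[OF _ inner_derivation_eigen_mult[OF A V X eV Suc.prems(2)]])
    show "v + w + of_nat j * u + of_nat (m - j) * v \<noteq> 0" if "j \<le> m" for j
      using Suc.prems(3)[of j] that by (simp add: Suc_diff_le algebra_simps)
  qed (use V X in auto)
  finally show ?case by simp
qed

lemma nilpotent_sum_of_eigenvectors:
  fixes z1 z2 :: real
  assumes A: "A \<in> carrier_mat n n" and U: "U \<in> carrier_mat n n" and V: "V \<in> carrier_mat n n"
    and eU: "inner_derivation A U = complex_of_real z1 \<cdot>\<^sub>m U"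
    and eV: "inner_derivation A V = complex_of_real z2 \<cdot>\<^sub>m V"
    and nr: "nonresonant n z1 z2" and "z1 \<noteq> 0" "z2 \<noteq> 0"
  shows "nilpotent_mat (U + V)"
proof (rule nilpotent_mat_if_traces_eq_zero)
  show "U + V \<in> carrier_mat n n"
    using U V by simp
  fix k :: nat assume k: "1 \<le> k" "k \<le> n"
  have "mat_trace ((U + V) ^\<^sub>m k * 1\<^sub>m n) = 0"
  proof (rule trace_pow_sum_of_eigenvectors[OF A U V eU eV])
    \<comment> \<open>The identity is the empty word, with eigenvalue zero.\<close>
    show "inner_derivation A (1\<^sub>m n) = 0 \<cdot>\<^sub>m 1\<^sub>m n"
      by (rule eq_matI) (use A in \<open>auto simp: inner_derivation_def\<close>)
    fix j assume j: "j \<le> k"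
    have "real j * z1 + real (k - j) * z2 \<noteq> 0"
    proof (cases "j = 0 \<or> j = k")
      case True
      then show ?thesis using assms k by auto
    next
      case False
      then show ?thesis
        using nr k j unfolding nonresonant_def by (auto simp del: of_nat_diff)
    qed
    then have "complex_of_real (real j * z1 + real (k - j) * z2) \<noteq> 0"
      by (simp only: of_real_eq_0_iff not_False_eq_True)
    then show "0 + of_nat j * complex_of_real z1 + of_nat (k - j) * complex_of_real z2 \<noteq> 0"
      by simp
  qed simp
  moreover have "(U + V) ^\<^sub>m k \<in> carrier_mat n n"
    using U V by simp
  ultimately show "mat_trace ((U + V) ^\<^sub>m k) = 0"
    by (metis right_mult_one_mat)
qed

lemma nilpotent_if_derivation_relation:
  fixes z1 z2 :: real
  assumes A: "A \<in> carrier_mat n n" and T: "T \<in> carrier_mat n n"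
    and nr: "nonresonant n z1 z2" and z: "z1 \<noteq> 0" "z2 \<noteq> 0" "z1 \<noteq> z2"
    and rel: "derivation_relation n (- (z1 + z2)) (z1 * z2) A T"
  shows "nilpotent_mat T \<and> nilpotent_mat (inner_derivation A T)"
proof -
  define D where "D = inner_derivation A T"
  define s where "s = 1 / (complex_of_real z1 - complex_of_real z2)"
  have s: "s * z1 - s * z2 = 1"
    using z by (simp add: s_def diff_divide_distrib[symmetric])
  have D: "D \<in> carrier_mat n n"
    using A T by (simp add: D_def)
  have E: "inner_derivation A D \<in> carrier_mat n n"
    using A D by simp
  have DD: "inner_derivation A D $$ (i, j) = (z1 + z2) * D $$ (i, j) - z1 * z2 * T $$ (i, j)"
    if "i < n" "j < n" for i j
  proof -
    have "(inner_derivation A D + complex_of_real (- (z1 + z2)) \<cdot>\<^sub>m D + complex_of_real (z1 * z2) \<cdot>\<^sub>m T) $$ (i, j)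
        = 0\<^sub>m n n $$ (i, j)"
      using rel by (simp add: derivation_relation_def D_def)
    then show ?thesis
      using that D T E by (simp add: algebra_simps)
  qed
  \<comment> \<open>\<open>U = s (D - z2 T)\<close> and \<open>V = - s (D - z1 T)\<close> are the projections of \<open>T\<close> to the two
      eigenspaces.\<close>
  define U where "U = s \<cdot>\<^sub>m D + (- s * z2) \<cdot>\<^sub>m T"
  define V where "V = (- s) \<cdot>\<^sub>m D + (s * z1) \<cdot>\<^sub>m T"
  have U: "U \<in> carrier_mat n n" and V: "V \<in> carrier_mat n n"
    using D T by (auto simp: U_def V_def)
  have eU: "inner_derivation A U = complex_of_real z1 \<cdot>\<^sub>m U"
    unfolding U_def inner_derivation_lincomb[OF A D T] D_def[symmetric]
    by (rule eq_matI) (use D T E in \<open>auto simp: DD algebra_simps\<close>)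
  have eV: "inner_derivation A V = complex_of_real z2 \<cdot>\<^sub>m V"
    unfolding V_def inner_derivation_lincomb[OF A D T] D_def[symmetric]
    by (rule eq_matI) (use D T E in \<open>auto simp: DD algebra_simps\<close>)
  \<comment> \<open>The scaled components are again eigenvectors, and they add up to \<open>D\<close>.\<close>
  have eU': "inner_derivation A (complex_of_real z1 \<cdot>\<^sub>m U) = complex_of_real z1 \<cdot>\<^sub>m (complex_of_real z1 \<cdot>\<^sub>m U)"
   and eV': "inner_derivation A (complex_of_real z2 \<cdot>\<^sub>m V) = complex_of_real z2 \<cdot>\<^sub>m (complex_of_real z2 \<cdot>\<^sub>m V)"
    by (simp_all only: inner_derivation_smult[OF A U] inner_derivation_smult[OF A V] eU eV)
  have partition: "s * z1 * M $$ ij - s * z2 * M $$ ij = M $$ ij" for M ij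
    using s by (metis left_diff_distrib mult_1)
  have "U + V = T"
    by (rule eq_matI) (use D T partition[of T] in \<open>auto simp: U_def V_def algebra_simps\<close>)
  moreover have "complex_of_real z1 \<cdot>\<^sub>m U + complex_of_real z2 \<cdot>\<^sub>m V = D"
    by (rule eq_matI) (use D T partition[of D] in \<open>auto simp: U_def V_def algebra_simps\<close>)
  ultimately show ?thesis
    using nilpotent_sum_of_eigenvectors[OF A U V eU eV nr z(1,2)]
      nilpotent_sum_of_eigenvectors[OF A _ _ eU' eV' nr z(1,2)] U V
    by (simp add: D_def)
qed

section \<open>Weighted cycles\<close>

definition weighted_cycle :: "nat \<Rightarrow> nat \<Rightarrow> (nat \<Rightarrow> complex) \<Rightarrow> complex mat" where
  "weighted_cycle n k w = mat n n (\<lambda>(r, c). if c < k \<and> r = Suc c mod k then w c else 0)"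

lemma weighted_cycle_carrier [simp]: "weighted_cycle n k w \<in> carrier_mat n n"
  by (simp add: weighted_cycle_def)

text \<open>The \<open>m\<close>-th power sends the basis vector \<open>c\<close> to a nonzero multiple of the basis vector
  \<open>(c + m) mod k\<close>, so no power vanishes.\<close>

lemma not_nilpotent_weighted_cycle:
  assumes k: "1 \<le> k" "k \<le> n" and w: "\<And>c. c < k \<Longrightarrow> w c \<noteq> 0"
  shows "\<not> nilpotent_mat (weighted_cycle n k w)"
proof -
  let ?M = "weighted_cycle n k w"
  have nz: "(?M ^\<^sub>m m) $$ ((c + m) mod k, c) \<noteq> 0" if "c < k" for c m
    using that
  proof (induction m arbitrary: c)
    case 0
    then show ?case using k by (auto simp: weighted_cycle_def)
  next
    case (Suc m)
    let ?r = "(c + Suc m) mod k" and ?l = "Suc c mod k"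
    have lk: "?l < k" and rk: "?r < k"
      using k by (auto intro: mod_less_divisor)
    have "(?M ^\<^sub>m Suc m) $$ (?r, c) = (\<Sum>l<n. (?M ^\<^sub>m m) $$ (?r, l) * ?M $$ (l, c))"
      using mat_mult_index[of "?M ^\<^sub>m m" n n ?M n ?r c]
        less_le_trans[OF rk k(2)] Suc.prems k by (simp del: index_mult_mat(1))
    also have "\<dots> = (\<Sum>l\<in>{?l}. (?M ^\<^sub>m m) $$ (?r, l) * ?M $$ (l, c))"
      using less_le_trans[OF lk k(2)] Suc.prems k by (intro sum.mono_neutral_right) (auto simp: weighted_cycle_def)
    also have "\<dots> = (?M ^\<^sub>m m) $$ ((?l + m) mod k, ?l) * w c"
      using less_le_trans[OF lk k(2)] Suc.prems k by (simp add: weighted_cycle_def mod_simps)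
    finally show ?case
      using Suc.IH[OF lk] w[OF Suc.prems] by simp
  qed
  have "?M ^\<^sub>m m \<noteq> 0\<^sub>m n n" for m
  proof
    assume "?M ^\<^sub>m m = 0\<^sub>m n n"
    moreover have "m mod k < n"
      using less_le_trans[OF mod_less_divisor[of k m] k(2)] k(1) by simp
    ultimately show False
      using nz[of 0 m] k by simp
  qed
  then show ?thesis
    unfolding nilpotent_mat_def by (auto simp: weighted_cycle_def)
qed

lemma inner_derivation_diagonal:
  assumes "T \<in> carrier_mat n n" "r < n" "c < n"
  shows "inner_derivation (mat n n (\<lambda>(i, j). if i = j then a i else 0)) T $$ (r, c)
    = (a r - a c) * T $$ (r, c)"
proof -
  let ?A = "mat n n (\<lambda>(i, j). if i = j then a i else 0)"
  have A: "?A \<in> carrier_mat n n" by simp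
  have "(?A * T) $$ (r, c) = (\<Sum>l<n. if l = r then a r * T $$ (r, c) else 0)"
    unfolding mat_mult_index[OF A assms] using assms by (intro sum.cong) auto
  moreover have "(T * ?A) $$ (r, c) = (\<Sum>l<n. if l = c then a c * T $$ (r, c) else 0)"
    unfolding mat_mult_index[OF assms(1) A assms(2,3)] using assms by (intro sum.cong) auto
  ultimately show ?thesis
    using assms by (simp add: inner_derivation_def sum.delta left_diff_distrib del: index_mult_mat(1))
qed

lemma inner_derivation_weighted_cycle:
  assumes "k \<le> n" "\<And>c. c < k \<Longrightarrow> a (Suc c mod k) - a c = d c"
  shows "inner_derivation (mat n n (\<lambda>(i, j). if i = j then a i else 0)) (weighted_cycle n k w)
    = weighted_cycle n k (\<lambda>c. d c * w c)"
proof (rule eq_matI)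
  fix r c
  assume "r < dim_row (weighted_cycle n k (\<lambda>c. d c * w c))" "c < dim_col (weighted_cycle n k (\<lambda>c. d c * w c))"
  then have rc: "r < n" "c < n"
    by (auto simp: weighted_cycle_def)
  show "inner_derivation (mat n n (\<lambda>(i, j). if i = j then a i else 0)) (weighted_cycle n k w) $$ (r, c)
    = weighted_cycle n k (\<lambda>c. d c * w c) $$ (r, c)"
    unfolding inner_derivation_diagonal[OF weighted_cycle_carrier rc]
    using rc assms(2)[of c] by (simp add: weighted_cycle_def)
qed (auto simp: inner_derivation_def weighted_cycle_def)

text \<open>The closed walk \<open>a\<close> first takes all \<open>j\<close> steps \<open>z1\<close>, then the \<open>k - j\<close> steps \<open>z2\<close>; the
  resonance is what makes it return to its start.\<close>

lemma resonant_counterexample: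
  fixes z1 z2 :: real
  assumes nz: "z1 \<noteq> 0" "z2 \<noteq> 0" and nr: "\<not> nonresonant n z1 z2"
  shows "\<exists>A\<in>carrier_mat n n. \<exists>T\<in>carrier_mat n n.
    derivation_relation n (- (z1 + z2)) (z1 * z2) A T \<and>
    \<not> nilpotent_mat T \<and> \<not> nilpotent_mat (inner_derivation A T)"
proof -
  obtain k j where k: "1 \<le> k" "k \<le> n" and j: "1 \<le> j" "j \<le> k - 1"
    and res: "real j * z1 + real (k - j) * z2 = 0"
    using nr by (auto simp: nonresonant_def)
  define a :: "nat \<Rightarrow> real" where
    "a i = (if i \<le> j then real i * z1 else real j * z1 + real (i - j) * z2)" for i
  define d :: "nat \<Rightarrow> complex" where "d c = (if c < j then z1 else z2)" for c
  have ak: "a k = a 0"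
    using res j k by (simp add: a_def)
  have "a (Suc c mod k) = a (Suc c)" if "c < k" for c
    using that ak by (cases "Suc c = k") auto
  then have step: "complex_of_real (a (Suc c mod k)) - complex_of_real (a c) = d c" if "c < k" for c
    using that by (cases "c < j"; cases "c = j") (auto simp: a_def d_def algebra_simps)
  let ?A = "mat n n (\<lambda>(i, j). if i = j then complex_of_real (a i) else 0)"
  let ?T = "weighted_cycle n k (\<lambda>_. 1)"
  have D: "inner_derivation ?A (weighted_cycle n k w) = weighted_cycle n k (\<lambda>c. d c * w c)" for w
    using step k by (intro inner_derivation_weighted_cycle) auto
  have "derivation_relation n (- (z1 + z2)) (z1 * z2) ?A ?T"
    unfolding derivation_relation_def D
    by (rule eq_matI) (auto simp: weighted_cycle_def d_def algebra_simps)
  moreover have "\<not> nilpotent_mat ?T"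
    using k by (intro not_nilpotent_weighted_cycle) auto
  moreover have "\<not> nilpotent_mat (inner_derivation ?A ?T)"
    unfolding D using k nz by (intro not_nilpotent_weighted_cycle) (auto simp: d_def)
  ultimately show ?thesis
    by (intro bexI[of _ ?A] bexI[of _ ?T]) auto
qed

theorem theorem6p1:
  fixes n :: nat and z1 z2 \<alpha> \<beta> :: real
  assumes "n \<ge> 1"
    and "z1 > 0" and "0 > z2"
    and "\<alpha> = - (z1 + z2)" and "\<beta> = z1 * z2"
  shows "(nonresonant n z1 z2 \<longrightarrow>
           (\<forall>A\<in>carrier_mat n n. \<forall>T\<in>carrier_mat n n. derivation_relation n \<alpha> \<beta> A T \<longrightarrow>
              nilpotent_mat T \<and> nilpotent_mat (inner_derivation A T)))
       \<and> (\<not> nonresonant n z1 z2 \<longrightarrow>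
           (\<exists>A\<in>carrier_mat n n. \<exists>T\<in>carrier_mat n n. derivation_relation n \<alpha> \<beta> A T \<and>
              \<not> nilpotent_mat T \<and> \<not> nilpotent_mat (inner_derivation A T)))"
proof (intro conjI impI ballI)
  show "nilpotent_mat T" "nilpotent_mat (inner_derivation A T)"
    if "nonresonant n z1 z2" "A \<in> carrier_mat n n" "T \<in> carrier_mat n n" "derivation_relation n \<alpha> \<beta> A T"
    for A T
    using nilpotent_if_derivation_relation[of A n T z1 z2] that assms by auto
  show "\<exists>A\<in>carrier_mat n n. \<exists>T\<in>carrier_mat n n. derivation_relation n \<alpha> \<beta> A T \<and>
      \<not> nilpotent_mat T \<and> \<not> nilpotent_mat (inner_derivation A T)"
    if "\<not> nonresonant n z1 z2"
    using resonant_counterexample[of z1 z2 n] that assms by auto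
qed

end
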